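(* Let $\Lambda$ be a normal modal logic with the Lyndon interpolation property (LIP). Then $\Lambda$ has the Lyndon positivity property (LPP).
   Context: Formulas. Fix a countably infinite set $\mathcal V$ of propositional variables. A literal is a variable $p$ or its negation $\neg p$. Modal formulas are built from literals and the constants $\bot,\top$ using $\wedge,\vee,\Diamond,\Box$; negation of an arbitrary formula is defined by the duality laws (De Morgan, $\neg\Diamond\varphi=\Box\neg\varphi$, $\neg\Box\varphi=\Diamond\neg\varphi$, $\neg\neg p=p$), and $\varphi\to\psi$ is $\neg\varphi\vee\psi$. $\mathrm{lits}(\varphi)$ is the set of literals occurring in $\varphi$ (so $\mathrm{lits}(\neg p)=\{\neg p\}$). $\varphi(\vec p,\bar r)$ means that all variables of $\varphi$ are among $\vec p,\bar r$; $\varphi(\vec\eta,\bar r)$ denotes simultaneous substitution (negations of formulas being expanded). Logics. A modal logic is a set $\Lambda$ of formulas containing all classical tautologies and closed under modus ponens, uniform substitution and the rule: from $\varphi\leftrightarrow\psi$ infer $\Diamond\varphi\leftrightarrow\Diamond\psi$. $\Lambda\vdash\varphi$ means $\varphi\in\Lambda$. $\Lambda$ is monotone if it contains $\Diamond p\to\Diamond(p\vee q)$; it is normal if it moreover contains $\Diamond(p\vee q)\to\Diamond p\vee\Diamond q$ and $\Box\top$. Formulas $\varphi,\psi$ are $\Lambda$-equivalent if $\Lambda\vdash\varphi\leftrightarrow\psi$. LIP. $\Lambda$ has LIP if whenever $\Lambda\vdash\varphi\to\psi$ there is a formula $\iota$ with $\mathrm{lits}(\iota)\subseteq\mathrm{lits}(\varphi)\cap\mathrm{lits}(\psi)$,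 $\Lambda\vdash\varphi\to\iota$ and $\Lambda\vdash\iota\to\psi$. LPP. Let $\vec p=(p_i)_{i<n}$, $\bar r=(r_j)_{j<m}$ be finite tuples of pairwise distinct variables. A formula $\varphi(\vec p,\bar r)$ is $\vec p$-positive if no $\neg p_i$ is in $\mathrm{lits}(\varphi)$. It is $\vec p$-monotone in $\Lambda$ if $\Lambda\vdash\varphi(\vec p,\bar r)\to\varphi(\vec p\vee\vec q,\bar r)$, where $\vec q=(q_i)_{i<n}$ is a tuple of fresh distinct variables and $\vec p\vee\vec q=(p_i\vee q_i)_{i<n}$. A monotone logic $\Lambda$ has LPP if for all such $\vec p,\bar r$, every formula $\varphi(\vec p,\bar r)$ that is $\vec p$-monotone in $\Lambda$ is $\Lambda$-equivalent to some $\vec p$-positive formula $\alpha(\vec p,\bar r)$. *)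

theory Defs
  imports Main
begin

datatype lit = Pos nat | Neg nat

datatype fm =
    Lit lit
  | Bot
  | Top
  | And fm fm
  | Or fm fm
  | Dia fm
  | Box fm

abbreviation Var :: "nat \<Rightarrow> fm" where
  "Var x \<equiv> Lit (Pos x)"

fun neg_lit :: "lit \<Rightarrow> lit" where
  "neg_lit (Pos x) = Neg x"
| "neg_lit (Neg x) = Pos x"

primrec neg :: "fm \<Rightarrow> fm" where
  "neg (Lit l) = Lit (neg_lit l)"
| "neg Bot = Top"
| "neg Top = Bot"
| "neg (And \<phi> \<psi>) = Or (neg \<phi>) (neg \<psi>)"
| "neg (Or \<phi> \<psi>) = And (neg \<phi>) (neg \<psi>)"
| "neg (Dia \<phi>) = Box (neg \<phi>)"
| "neg (Box \<phi>) = Dia (neg \<phi>)"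

definition imp :: "fm \<Rightarrow> fm \<Rightarrow> fm" where
  "imp \<phi> \<psi> = Or (neg \<phi>) \<psi>"

definition iff :: "fm \<Rightarrow> fm \<Rightarrow> fm" where
  "iff \<phi> \<psi> = And (imp \<phi> \<psi>) (imp \<psi> \<phi>)"

primrec lits :: "fm \<Rightarrow> lit set" where
  "lits (Lit l) = {l}"
| "lits Bot = {}"
| "lits Top = {}"
| "lits (And \<phi> \<psi>) = lits \<phi> \<union> lits \<psi>"
| "lits (Or \<phi> \<psi>) = lits \<phi> \<union> lits \<psi>"
| "lits (Dia \<phi>) = lits \<phi>"
| "lits (Box \<phi>) = lits \<phi>"

definition vars :: "fm \<Rightarrow> nat set" where
  "vars \<phi> = {x. Pos x \<in> lits \<phi> \<or> Neg x \<in> lits \<phi>}"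

fun subst_lit :: "(nat \<Rightarrow> fm) \<Rightarrow> lit \<Rightarrow> fm" where
  "subst_lit \<sigma> (Pos x) = \<sigma> x"
| "subst_lit \<sigma> (Neg x) = neg (\<sigma> x)"

primrec subst :: "(nat \<Rightarrow> fm) \<Rightarrow> fm \<Rightarrow> fm" where
  "subst \<sigma> (Lit l) = subst_lit \<sigma> l"
| "subst \<sigma> Bot = Bot"
| "subst \<sigma> Top = Top"
| "subst \<sigma> (And \<phi> \<psi>) = And (subst \<sigma> \<phi>) (subst \<sigma> \<psi>)"
| "subst \<sigma> (Or \<phi> \<psi>) = Or (subst \<sigma> \<phi>) (subst \<sigma> \<psi>)"
| "subst \<sigma> (Dia \<phi>) = Dia (subst \<sigma> \<phi>)"
| "subst \<sigma> (Box \<phi>) = Box (subst \<sigma> \<phi>)"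

primrec modality_free :: "fm \<Rightarrow> bool" where
  "modality_free (Lit l) = True"
| "modality_free Bot = True"
| "modality_free Top = True"
| "modality_free (And \<phi> \<psi>) = (modality_free \<phi> \<and> modality_free \<psi>)"
| "modality_free (Or \<phi> \<psi>) = (modality_free \<phi> \<and> modality_free \<psi>)"
| "modality_free (Dia \<phi>) = False"
| "modality_free (Box \<phi>) = False"

fun lit_true :: "(nat \<Rightarrow> bool) \<Rightarrow> lit \<Rightarrow> bool" where
  "lit_true v (Pos x) = v x"
| "lit_true v (Neg x) = (\<not> v x)"

text \<open>Boolean truth value; it is only ever used on modality-free formulas, so the two
  modal clauses are arbitrary.\<close>
primrec bool_val :: "(nat \<Rightarrow> bool) \<Rightarrow> fm \<Rightarrow> bool" where
  "bool_val v (Lit l) = lit_true v l"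
| "bool_val v Bot = False"
| "bool_val v Top = True"
| "bool_val v (And \<phi> \<psi>) = (bool_val v \<phi> \<and> bool_val v \<psi>)"
| "bool_val v (Or \<phi> \<psi>) = (bool_val v \<phi> \<or> bool_val v \<psi>)"
| "bool_val v (Dia \<phi>) = undefined"
| "bool_val v (Box \<phi>) = undefined"

text \<open>Tautologies of classical propositional logic. Their modal instances, such as
  \<open>Or (Box \<phi>) (neg (Box \<phi>))\<close>, enter a modal logic by uniform substitution.\<close>
definition tautology :: "fm \<Rightarrow> bool" where
  "tautology \<phi> \<longleftrightarrow> modality_free \<phi> \<and> (\<forall>v. bool_val v \<phi>)"

definition modal_logic :: "fm set \<Rightarrow> bool" where
  "modal_logic \<Lambda> \<longleftrightarrow>
     (\<forall>\<phi>. tautology \<phi> \<longrightarrow> \<phi> \<in> \<Lambda>) \<and>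
     (\<forall>\<phi> \<psi>. imp \<phi> \<psi> \<in> \<Lambda> \<longrightarrow> \<phi> \<in> \<Lambda> \<longrightarrow> \<psi> \<in> \<Lambda>) \<and>
     (\<forall>\<sigma> \<phi>. \<phi> \<in> \<Lambda> \<longrightarrow> subst \<sigma> \<phi> \<in> \<Lambda>) \<and>
     (\<forall>\<phi> \<psi>. iff \<phi> \<psi> \<in> \<Lambda> \<longrightarrow> iff (Dia \<phi>) (Dia \<psi>) \<in> \<Lambda>)"

text \<open>In this axiom and in those of normality, \<open>p\<close> and \<open>q\<close> are taken to be the variables 0 and 1; by closure
  under uniform substitution the choice of distinct variables is immaterial.\<close>
definition monotone_logic :: "fm set \<Rightarrow> bool" where
  "monotone_logic \<Lambda> \<longleftrightarrow>
     modal_logic \<Lambda> \<and> imp (Dia (Var 0)) (Dia (Or (Var 0) (Var 1))) \<in> \<Lambda>"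

definition normal_logic :: "fm set \<Rightarrow> bool" where
  "normal_logic \<Lambda> \<longleftrightarrow>
     monotone_logic \<Lambda> \<and>
     imp (Dia (Or (Var 0) (Var 1))) (Or (Dia (Var 0)) (Dia (Var 1))) \<in> \<Lambda> \<and>
     Box Top \<in> \<Lambda>"

definition LIP :: "fm set \<Rightarrow> bool" where
  "LIP \<Lambda> \<longleftrightarrow>
     (\<forall>\<phi> \<psi>. imp \<phi> \<psi> \<in> \<Lambda> \<longrightarrow>
        (\<exists>\<iota>. lits \<iota> \<subseteq> lits \<phi> \<inter> lits \<psi> \<and> imp \<phi> \<iota> \<in> \<Lambda> \<and> imp \<iota> \<psi> \<in> \<Lambda>))"

definition positive_in :: "nat list \<Rightarrow> fm \<Rightarrow> bool" where
  "positive_in ps \<phi> \<longleftrightarrow> (\<forall>p \<in> set ps. Neg p \<notin> lits \<phi>)"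

text \<open>The substitution replacing \<open>p\<^sub>i\<close> by \<open>p\<^sub>i \<or> q\<^sub>i\<close>, for \<open>ps\<close> distinct and as long as \<open>qs\<close>.\<close>
definition join_subst :: "nat list \<Rightarrow> nat list \<Rightarrow> nat \<Rightarrow> fm" where
  "join_subst ps qs x =
     (case map_of (zip ps qs) x of None \<Rightarrow> Var x | Some q \<Rightarrow> Or (Var x) (Var q))"

text \<open>For a modal logic \<open>\<Lambda>\<close>, which is closed under substitution, it does not matter which
  tuple \<open>qs\<close> of fresh distinct variables is used.\<close>
definition monotone_in :: "fm set \<Rightarrow> nat list \<Rightarrow> nat list \<Rightarrow> fm \<Rightarrow> bool" where
  "monotone_in \<Lambda> ps rs \<phi> \<longleftrightarrow>
     (\<exists>qs. length qs = length ps \<and> distinct qs \<and> set qs \<inter> set (ps @ rs) = {} \<and>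
        imp \<phi> (subst (join_subst ps qs) \<phi>) \<in> \<Lambda>)"

text \<open>Meant for monotone logics only.\<close>
definition LPP :: "fm set \<Rightarrow> bool" where
  "LPP \<Lambda> \<longleftrightarrow>
     (\<forall>ps rs \<phi>. distinct (ps @ rs) \<longrightarrow> vars \<phi> \<subseteq> set (ps @ rs) \<longrightarrow> monotone_in \<Lambda> ps rs \<phi> \<longrightarrow>
        (\<exists>\<alpha>. vars \<alpha> \<subseteq> set (ps @ rs) \<and> positive_in ps \<alpha> \<and> iff \<phi> \<alpha> \<in> \<Lambda>))"

end

theory Submission
  imports Defs "HOL-Library.Countable"
begin

text \<open>
  Write \<open>\<phi>(p, r)\<close> for the given formula and \<open>q\<close> for the fresh copy of \<open>p\<close>. Monotonicity says
  that \<open>\<phi>(p, r)\<close> implies \<open>\<phi>(p \<or> q, r)\<close>. If \<open>p \<rightarrow> q\<close> holds at the current point and at all points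
  that evaluating \<open>\<phi>\<close> can reach, then \<open>p \<or> q\<close> and \<open>q\<close> are interchangeable inside \<open>\<phi>\<close>. In a normal
  logic the hypothesis of that sentence is a single formula \<open>G\<close>, obtained from
  \<open>\<chi> = \<And>\<^sub>i (p\<^sub>i \<rightarrow> q\<^sub>i)\<close> by prefixing boxes (\<open>guard\<close>, lemma \<open>guarded_replacement\<close>). Hence
  \<open>\<phi>(p, r) \<rightarrow> (G \<rightarrow> \<phi>(q, r))\<close> is a theorem.

  In the consequent of this implication the variables \<open>p\<close> occur only in \<open>G\<close>, where they are negative,
  hence positively in \<open>G \<rightarrow> \<phi>(q, r)\<close>; and the variables \<open>q\<close> do not occur in \<open>\<phi>(p, r)\<close>. A Lyndon
  interpolant \<open>\<iota>\<close> is therefore a \<open>p\<close>-positive formula in \<open>p, r\<close>. It is implied by \<open>\<phi>\<close>;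
  conversely, substituting \<open>p\<close> back for \<open>q\<close> in \<open>\<iota> \<rightarrow> (G \<rightarrow> \<phi>(q, r))\<close> turns \<open>G\<close> into a theorem by
  necessitation, and leaves \<open>\<iota> \<rightarrow> \<phi>\<close>.

  Propositional steps inside a logic are settled semantically: a formula that is true under all
  valuations treating formulas \<open>Dia \<psi>\<close> as atoms belongs to every modal logic
  (\<open>propositional_consequence\<close>).
\<close>

section \<open>Syntax\<close>

lemma neg_lit_neg_lit [simp]: "neg_lit (neg_lit l) = l"
  by (cases l) auto

lemma neg_neg [simp]: "neg (neg \<phi>) = \<phi>"
  by (induction \<phi>) auto

lemma subst_neg [simp]: "subst \<sigma> (neg \<phi>) = neg (subst \<sigma> \<phi>)"
proof (induction \<phi>)
  case (Lit l)
  then show ?case by (cases l) auto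
qed auto

lemma subst_imp [simp]: "subst \<sigma> (imp \<phi> \<psi>) = imp (subst \<sigma> \<phi>) (subst \<sigma> \<psi>)"
  by (simp add: imp_def)

lemma vars_simps [simp]:
  "vars (Lit (Pos x)) = {x}" "vars (Lit (Neg x)) = {x}" "vars Bot = {}" "vars Top = {}"
  "vars (And \<phi> \<psi>) = vars \<phi> \<union> vars \<psi>" "vars (Or \<phi> \<psi>) = vars \<phi> \<union> vars \<psi>"
  "vars (Dia \<phi>) = vars \<phi>" "vars (Box \<phi>) = vars \<phi>"
  by (auto simp: vars_def)

lemma lits_neg: "lits (neg \<phi>) = neg_lit ` lits \<phi>"
  by (induction \<phi>) auto

lemma vars_neg [simp]: "vars (neg \<phi>) = vars \<phi>"
proof (induction \<phi>)
  case (Lit l)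
  then show ?case by (cases l) auto
qed auto

lemma vars_subst: "vars (subst \<sigma> \<phi>) = (\<Union>x\<in>vars \<phi>. vars (\<sigma> x))"
proof (induction \<phi>)
  case (Lit l)
  then show ?case by (cases l) auto
qed auto

lemma subst_subst: "subst \<tau> (subst \<sigma> \<phi>) = subst (\<lambda>x. subst \<tau> (\<sigma> x)) \<phi>"
proof (induction \<phi>)
  case (Lit l)
  then show ?case by (cases l) auto
qed auto

lemma subst_identity: "(\<And>x. x \<in> vars \<phi> \<Longrightarrow> \<sigma> x = Var x) \<Longrightarrow> subst \<sigma> \<phi> = \<phi>"
proof (induction \<phi>)
  case (Lit l)
  then show ?case by (cases l) auto
qed auto

section \<open>Propositional reasoning in a modal logic\<close>

instance lit :: countable
  by countable_datatype

instance fm :: countable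
  by countable_datatype

text \<open>A box is not an atom of its own but the negation of a diamond, so that \<open>neg\<close> is
  always interpreted as Boolean negation.\<close>
primrec truth :: "(fm \<Rightarrow> bool) \<Rightarrow> fm \<Rightarrow> bool" where
  "truth v (Lit l) = lit_true (\<lambda>x. v (Var x)) l"
| "truth v Bot = False"
| "truth v Top = True"
| "truth v (And \<phi> \<psi>) = (truth v \<phi> \<and> truth v \<psi>)"
| "truth v (Or \<phi> \<psi>) = (truth v \<phi> \<or> truth v \<psi>)"
| "truth v (Dia \<phi>) = v (Dia \<phi>)"
| "truth v (Box \<phi>) = (\<not> v (Dia (neg \<phi>)))"

lemma truth_neg [simp]: "truth v (neg \<phi>) \<longleftrightarrow> \<not> truth v \<phi>"
proof (induction \<phi>)
  case (Lit l)
  then show ?case by (cases l) auto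
qed auto

lemma truth_imp [simp]: "truth v (imp \<phi> \<psi>) \<longleftrightarrow> (truth v \<phi> \<longrightarrow> truth v \<psi>)"
  by (auto simp: imp_def)

lemma truth_iff [simp]: "truth v (iff \<phi> \<psi>) \<longleftrightarrow> (truth v \<phi> \<longleftrightarrow> truth v \<psi>)"
  by (auto simp: iff_def)

text \<open>The modality-free shape of a formula, of which the formula is the instance under
  \<open>from_nat\<close>. The old variables are renumbered as well, which keeps them apart
  from the variables that stand for diamond formulas.\<close>
primrec skeleton :: "fm \<Rightarrow> fm" where
  "skeleton (Lit l) =
     (case l of Pos x \<Rightarrow> Var (to_nat (Var x)) | Neg x \<Rightarrow> Lit (Neg (to_nat (Var x))))"
| "skeleton Bot = Bot"
| "skeleton Top = Top"
| "skeleton (And \<phi> \<psi>) = And (skeleton \<phi>) (skeleton \<psi>)"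
| "skeleton (Or \<phi> \<psi>) = Or (skeleton \<phi>) (skeleton \<psi>)"
| "skeleton (Dia \<phi>) = Var (to_nat (Dia \<phi>))"
| "skeleton (Box \<phi>) = Lit (Neg (to_nat (Dia (neg \<phi>))))"

lemma modality_free_skeleton: "modality_free (skeleton \<phi>)"
  by (induction \<phi>) (auto split: lit.split)

lemma bool_val_skeleton: "bool_val u (skeleton \<phi>) = truth (\<lambda>\<psi>. u (to_nat \<psi>)) \<phi>"
  by (induction \<phi>) (auto split: lit.split)

lemma subst_skeleton: "subst from_nat (skeleton \<phi>) = \<phi>"
  by (induction \<phi>) (auto split: lit.split)

lemma modal_logic_contains_truths:
  assumes "modal_logic \<Lambda>" "\<And>v. truth v \<phi>"
  shows "\<phi> \<in> \<Lambda>"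
proof -
  have "tautology (skeleton \<phi>)"
    using assms(2) by (simp add: tautology_def modality_free_skeleton bool_val_skeleton)
  then have "subst from_nat (skeleton \<phi>) \<in> \<Lambda>"
    using assms(1) by (auto simp: modal_logic_def)
  then show ?thesis
    by (simp add: subst_skeleton)
qed

lemma propositional_consequence:
  assumes "modal_logic \<Lambda>" "set \<phi>s \<subseteq> \<Lambda>" "\<And>v. \<forall>\<phi>\<in>set \<phi>s. truth v \<phi> \<Longrightarrow> truth v \<psi>"
  shows "\<psi> \<in> \<Lambda>"
  using assms(2,3)
proof (induction \<phi>s arbitrary: \<psi>)
  case Nil
  then show ?case
    using modal_logic_contains_truths[OF assms(1)] by auto
next
  case (Cons \<phi> \<phi>s)
  have "imp \<phi> \<psi> \<in> \<Lambda>"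
    using Cons.prems by (intro Cons.IH) auto
  with Cons.prems(1) assms(1) show ?case
    unfolding modal_logic_def by auto
qed

section \<open>Modal reasoning in a normal logic\<close>

lemma normal_logic_modal: "normal_logic \<Lambda> \<Longrightarrow> modal_logic \<Lambda>"
  by (simp add: normal_logic_def monotone_logic_def)

lemma logic_subst: "modal_logic \<Lambda> \<Longrightarrow> \<phi> \<in> \<Lambda> \<Longrightarrow> subst \<sigma> \<phi> \<in> \<Lambda>"
  by (simp add: modal_logic_def)

lemma Dia_cong: "modal_logic \<Lambda> \<Longrightarrow> iff \<phi> \<psi> \<in> \<Lambda> \<Longrightarrow> iff (Dia \<phi>) (Dia \<psi>) \<in> \<Lambda>"
  by (simp add: modal_logic_def)

lemma Dia_mono:
  assumes "monotone_logic \<Lambda>" "imp \<phi> \<psi> \<in> \<Lambda>"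
  shows "imp (Dia \<phi>) (Dia \<psi>) \<in> \<Lambda>"
proof -
  have ml: "modal_logic \<Lambda>"
    using assms(1) by (simp add: monotone_logic_def)
  have "iff (Or \<phi> \<psi>) \<psi> \<in> \<Lambda>"
    by (rule propositional_consequence[OF ml, of "[imp \<phi> \<psi>]"]) (use assms(2) in auto)
  then have "iff (Dia (Or \<phi> \<psi>)) (Dia \<psi>) \<in> \<Lambda>"
    by (rule Dia_cong[OF ml])
  moreover have "imp (Dia \<phi>) (Dia (Or \<phi> \<psi>)) \<in> \<Lambda>"
    using logic_subst[OF ml, of "imp (Dia (Var 0)) (Dia (Or (Var 0) (Var 1)))"
        "\<lambda>x. if x = 0 then \<phi> else \<psi>"] assms(1)
    by (simp add: monotone_logic_def)
  ultimately show ?thesis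
    by (intro propositional_consequence[OF ml,
          of "[iff (Dia (Or \<phi> \<psi>)) (Dia \<psi>), imp (Dia \<phi>) (Dia (Or \<phi> \<psi>))]"]) auto
qed

text \<open>A boxed hypothesis may be used under a diamond: moved to the right, the hypothesis
  \<open>\<chi>\<close> becomes a disjunct \<open>\<not>\<chi>\<close>, over which the diamond distributes, and \<open>\<diamond>\<not>\<chi>\<close> refutes
  \<open>\<box>\<chi>\<close>.\<close>
lemma Dia_mono_under_Box:
  assumes "normal_logic \<Lambda>" "imp \<chi> (imp \<phi> \<psi>) \<in> \<Lambda>"
  shows "imp (Box \<chi>) (imp (Dia \<phi>) (Dia \<psi>)) \<in> \<Lambda>"
proof -
  note ml = normal_logic_modal[OF assms(1)]
  have "imp \<phi> (Or \<psi> (neg \<chi>)) \<in> \<Lambda>"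
    by (rule propositional_consequence[OF ml, of "[imp \<chi> (imp \<phi> \<psi>)]"]) (use assms(2) in auto)
  then have "imp (Dia \<phi>) (Dia (Or \<psi> (neg \<chi>))) \<in> \<Lambda>"
    using assms(1) by (intro Dia_mono) (simp add: normal_logic_def)
  moreover have "imp (Dia (Or \<psi> (neg \<chi>))) (Or (Dia \<psi>) (Dia (neg \<chi>))) \<in> \<Lambda>"
    using logic_subst[OF ml, of "imp (Dia (Or (Var 0) (Var 1))) (Or (Dia (Var 0)) (Dia (Var 1)))"
        "\<lambda>x. if x = 0 then \<psi> else neg \<chi>"] assms(1)
    by (simp add: normal_logic_def)
  ultimately show ?thesis
    by (intro propositional_consequence[OF ml,
          of "[imp (Dia \<phi>) (Dia (Or \<psi> (neg \<chi>))),
               imp (Dia (Or \<psi> (neg \<chi>))) (Or (Dia \<psi>) (Dia (neg \<chi>)))]"]) auto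
qed

lemma Dia_cong_under_Box:
  assumes "normal_logic \<Lambda>" "imp \<chi> (iff \<phi> \<psi>) \<in> \<Lambda>"
  shows "imp (Box \<chi>) (iff (Dia \<phi>) (Dia \<psi>)) \<in> \<Lambda>"
proof -
  note ml = normal_logic_modal[OF assms(1)]
  have "imp \<chi> (imp \<phi> \<psi>) \<in> \<Lambda>" "imp \<chi> (imp \<psi> \<phi>) \<in> \<Lambda>"
    by (rule propositional_consequence[OF ml, of "[imp \<chi> (iff \<phi> \<psi>)]"]; use assms(2) in auto)+
  then have "imp (Box \<chi>) (imp (Dia \<phi>) (Dia \<psi>)) \<in> \<Lambda>" "imp (Box \<chi>) (imp (Dia \<psi>) (Dia \<phi>)) \<in> \<Lambda>"
    by (auto intro: Dia_mono_under_Box[OF assms(1)])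
  then show ?thesis
    by (intro propositional_consequence[OF ml,
          of "[imp (Box \<chi>) (imp (Dia \<phi>) (Dia \<psi>)), imp (Box \<chi>) (imp (Dia \<psi>) (Dia \<phi>))]"]) auto
qed

lemma Box_cong_under_Box:
  assumes "normal_logic \<Lambda>" "imp \<chi> (iff \<phi> \<psi>) \<in> \<Lambda>"
  shows "imp (Box \<chi>) (iff (Box \<phi>) (Box \<psi>)) \<in> \<Lambda>"
proof -
  note ml = normal_logic_modal[OF assms(1)]
  have "imp \<chi> (iff (neg \<phi>) (neg \<psi>)) \<in> \<Lambda>"
    by (rule propositional_consequence[OF ml, of "[imp \<chi> (iff \<phi> \<psi>)]"]) (use assms(2) in auto)
  then have "imp (Box \<chi>) (iff (Dia (neg \<phi>)) (Dia (neg \<psi>))) \<in> \<Lambda>"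
    by (rule Dia_cong_under_Box[OF assms(1)])
  then show ?thesis
    by (intro propositional_consequence[OF ml,
          of "[imp (Box \<chi>) (iff (Dia (neg \<phi>)) (Dia (neg \<psi>)))]"]) auto
qed

lemma necessitation:
  assumes "normal_logic \<Lambda>" "\<phi> \<in> \<Lambda>"
  shows "Box \<phi> \<in> \<Lambda>"
proof -
  note ml = normal_logic_modal[OF assms(1)]
  have "iff (neg \<phi>) Bot \<in> \<Lambda>"
    by (rule propositional_consequence[OF ml, of "[\<phi>]"]) (use assms(2) in auto)
  then have "iff (Dia (neg \<phi>)) (Dia Bot) \<in> \<Lambda>"
    by (rule Dia_cong[OF ml])
  moreover have "Box Top \<in> \<Lambda>"
    using assms(1) by (simp add: normal_logic_def)
  ultimately show ?thesis
    by (intro propositional_consequence[OF ml, of "[iff (Dia (neg \<phi>)) (Dia Bot), Box Top]"]) auto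
qed

section \<open>Guards\<close>

text \<open>\<open>guard \<chi> \<phi>\<close> asserts \<open>\<chi>\<close> at every point where the evaluation of \<open>\<phi>\<close> may inspect a
  literal: a copy of \<open>\<chi>\<close> for each literal occurrence, under one box for each modality
  above that occurrence. Following the structure of \<open>\<phi>\<close> in this way, rather than taking
  \<open>\<chi> \<and> \<box>\<chi> \<and> \<dots> \<and> \<box>\<^sup>d\<chi>\<close> for the modal depth \<open>d\<close>, makes proofs by induction on \<open>\<phi>\<close>
  immediate.\<close>
primrec guard :: "fm \<Rightarrow> fm \<Rightarrow> fm" where
  "guard \<chi> (Lit l) = \<chi>"
| "guard \<chi> Bot = Top"
| "guard \<chi> Top = Top"
| "guard \<chi> (And \<phi> \<psi>) = And (guard \<chi> \<phi>) (guard \<chi> \<psi>)"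
| "guard \<chi> (Or \<phi> \<psi>) = And (guard \<chi> \<phi>) (guard \<chi> \<psi>)"
| "guard \<chi> (Dia \<phi>) = Box (guard \<chi> \<phi>)"
| "guard \<chi> (Box \<phi>) = Box (guard \<chi> \<phi>)"

lemma lits_guard: "lits (guard \<chi> \<phi>) \<subseteq> lits \<chi>"
  by (induction \<phi>) auto

lemma subst_guard: "subst \<sigma> (guard \<chi> \<phi>) = guard (subst \<sigma> \<chi>) \<phi>"
  by (induction \<phi>) auto

lemma guard_theorem:
  assumes "normal_logic \<Lambda>" "\<chi> \<in> \<Lambda>"
  shows "guard \<chi> \<phi> \<in> \<Lambda>"
proof (induction \<phi>)
  case (And \<phi> \<psi>)
  then show ?case
    by (intro propositional_consequence[OF normal_logic_modal[OF assms(1)],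
          of "[guard \<chi> \<phi>, guard \<chi> \<psi>]"]) auto
next
  case (Or \<phi> \<psi>)
  then show ?case
    by (intro propositional_consequence[OF normal_logic_modal[OF assms(1)],
          of "[guard \<chi> \<phi>, guard \<chi> \<psi>]"]) auto
qed (auto simp: assms necessitation modal_logic_contains_truths normal_logic_modal)

text \<open>Two substitutions that agree under the hypothesis \<open>\<chi>\<close> give equivalent instances of \<open>\<phi>\<close>
  under the guard: each modality above a literal is crossed with the congruence rules for
  boxed hypotheses, at the price of one box on \<open>\<chi>\<close>.\<close>
lemma guarded_replacement:
  assumes "normal_logic \<Lambda>" "\<And>x. x \<in> vars \<phi> \<Longrightarrow> imp \<chi> (iff (\<sigma> x) (\<tau> x)) \<in> \<Lambda>"
  shows "imp (guard \<chi> \<phi>) (iff (subst \<sigma> \<phi>) (subst \<tau> \<phi>)) \<in> \<Lambda>"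
  using assms(2)
proof (induction \<phi>)
  note ml = normal_logic_modal[OF assms(1)]
  {
    case (Lit l)
    show ?case
    proof (cases l)
      case (Pos x)
      then show ?thesis using Lit by auto
    next
      case (Neg x)
      then have "imp \<chi> (iff (\<sigma> x) (\<tau> x)) \<in> \<Lambda>"
        using Lit by auto
      then show ?thesis
        by (intro propositional_consequence[OF ml, of "[imp \<chi> (iff (\<sigma> x) (\<tau> x))]"])
          (auto simp: Neg)
    qed
  next
    case Bot
    show ?case by (rule modal_logic_contains_truths[OF ml]) simp
  next
    case Top
    show ?case by (rule modal_logic_contains_truths[OF ml]) simp
  next
    case (And \<phi> \<psi>)
    then show ?case
      by (intro propositional_consequence[OF ml,
            of "[imp (guard \<chi> \<phi>) (iff (subst \<sigma> \<phi>) (subst \<tau> \<phi>)),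
                 imp (guard \<chi> \<psi>) (iff (subst \<sigma> \<psi>) (subst \<tau> \<psi>))]"]) auto
  next
    case (Or \<phi> \<psi>)
    then show ?case
      by (intro propositional_consequence[OF ml,
            of "[imp (guard \<chi> \<phi>) (iff (subst \<sigma> \<phi>) (subst \<tau> \<phi>)),
                 imp (guard \<chi> \<psi>) (iff (subst \<sigma> \<psi>) (subst \<tau> \<psi>))]"]) auto
  next
    case (Dia \<phi>)
    then show ?case by (simp add: Dia_cong_under_Box[OF assms(1)])
  next
    case (Box \<phi>)
    then show ?case by (simp add: Box_cong_under_Box[OF assms(1)])
  }
qed

section \<open>Renaming a tuple of variables\<close>

definition rename :: "nat list \<Rightarrow> nat list \<Rightarrow> nat \<Rightarrow> fm" where
  "rename ps qs x = (case map_of (zip ps qs) x of None \<Rightarrow> Var x | Some q \<Rightarrow> Var q)"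

lemma rename_notin: "x \<notin> set ps \<Longrightarrow> rename ps qs x = Var x"
  by (auto simp: rename_def split: option.split dest!: map_of_SomeD set_zip_leftD)

lemma rename_zip: "distinct ps \<Longrightarrow> (p, q) \<in> set (zip ps qs) \<Longrightarrow> rename ps qs p = Var q"
  by (metis map_of_eq_Some_iff map_fst_zip_take distinct_take option.simps(5) rename_def)

lemma zip_partner:
  assumes "length qs = length ps" "x \<in> set ps"
  obtains q where "(x, q) \<in> set (zip ps qs)" "q \<in> set qs"
  using assms by (metis in_set_impl_in_set_zip1 set_zip_rightD)

lemma zip_commute_set: "(x, y) \<in> set (zip xs ys) \<Longrightarrow> (y, x) \<in> set (zip ys xs)"
  by (auto simp: set_zip)

lemma rename_back:
  assumes "length qs = length ps" "distinct ps" "distinct qs" "x \<notin> set qs"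
  shows "subst (rename qs ps) (rename ps qs x) = Var x"
proof (cases "x \<in> set ps")
  case True
  then obtain q where "(x, q) \<in> set (zip ps qs)"
    using zip_partner[OF assms(1)] by blast
  then show ?thesis
    using rename_zip[OF assms(2)] rename_zip[OF assms(3) zip_commute_set] by simp
next
  case False
  then show ?thesis
    using rename_notin assms(4) by simp
qed

primrec below :: "(nat \<times> nat) list \<Rightarrow> fm" where
  "below [] = Top"
| "below (pq # pqs) = And (imp (Var (fst pq)) (Var (snd pq))) (below pqs)"

lemma lits_below: "lits (below pqs) = (\<Union>(p, q)\<in>set pqs. {Neg p, Pos q})"
  by (induction pqs) (auto simp: imp_def)

lemma truth_below: "truth v (below pqs) \<longleftrightarrow> (\<forall>(p, q)\<in>set pqs. v (Var p) \<longrightarrow> v (Var q))"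
  by (induction pqs) auto

lemma truth_subst_below:
  "truth v (subst \<sigma> (below pqs)) \<longleftrightarrow> (\<forall>(p, q)\<in>set pqs. truth v (\<sigma> p) \<longrightarrow> truth v (\<sigma> q))"
  by (induction pqs) auto

lemma join_eq_rename_if_below:
  assumes "modal_logic \<Lambda>"
  shows "imp (below (zip ps qs)) (iff (join_subst ps qs x) (rename ps qs x)) \<in> \<Lambda>"
  by (rule modal_logic_contains_truths[OF assms])
    (auto simp: truth_below join_subst_def rename_def split: option.split dest!: map_of_SomeD)

section \<open>From interpolation to positivity\<close>

theorem theorem4p4:
  fixes \<Lambda> :: "fm set"
  assumes "normal_logic \<Lambda>"
    and "LIP \<Lambda>"
  shows "LPP \<Lambda>"
  unfolding LPP_def
proof (intro allI impI)
  fix ps rs :: "nat list" and \<phi> :: fm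
  assume dist: "distinct (ps @ rs)" and vars: "vars \<phi> \<subseteq> set (ps @ rs)"
    and mono: "monotone_in \<Lambda> ps rs \<phi>"
  note ml = normal_logic_modal[OF assms(1)]
  from mono obtain qs where len: "length qs = length ps" and qs: "distinct qs"
    and fresh: "set qs \<inter> set (ps @ rs) = {}"
    and join: "imp \<phi> (subst (join_subst ps qs) \<phi>) \<in> \<Lambda>"
    unfolding monotone_in_def by blast
  define \<chi> where "\<chi> = below (zip ps qs)"
  define \<phi>q where "\<phi>q = subst (rename ps qs) \<phi>"
  have "imp (guard \<chi> \<phi>) (iff (subst (join_subst ps qs) \<phi>) \<phi>q) \<in> \<Lambda>"
    unfolding \<phi>q_def \<chi>_def
    by (rule guarded_replacement[OF assms(1)]) (rule join_eq_rename_if_below[OF ml])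
  with join have "imp \<phi> (imp (guard \<chi> \<phi>) \<phi>q) \<in> \<Lambda>"
    by (intro propositional_consequence[OF ml,
          of "[imp \<phi> (subst (join_subst ps qs) \<phi>),
               imp (guard \<chi> \<phi>) (iff (subst (join_subst ps qs) \<phi>) \<phi>q)]"]) auto
  then obtain \<iota> where lits: "lits \<iota> \<subseteq> lits \<phi> \<inter> lits (imp (guard \<chi> \<phi>) \<phi>q)"
    and \<iota>1: "imp \<phi> \<iota> \<in> \<Lambda>" and \<iota>2: "imp \<iota> (imp (guard \<chi> \<phi>) \<phi>q) \<in> \<Lambda>"
    using assms(2) unfolding LIP_def by blast
  have vars\<iota>: "vars \<iota> \<subseteq> set (ps @ rs)"
    using lits vars by (auto simp: vars_def)

  have "positive_in ps \<iota>"
    unfolding positive_in_def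
  proof
    fix p assume p: "p \<in> set ps"
    \<comment> \<open>The negation of the guard contains only literals \<open>Pos p\<close> and \<open>Neg q\<close>.\<close>
    have "Neg p \<notin> lits (neg (guard \<chi> \<phi>))"
    proof
      assume "Neg p \<in> lits (neg (guard \<chi> \<phi>))"
      then obtain l where l: "l \<in> lits \<chi>" "neg_lit l = Neg p"
        using lits_guard[of \<chi> \<phi>] by (auto simp: lits_neg)
      then have "Pos p \<in> lits \<chi>"
        by (cases l) auto
      then have "p \<in> set qs"
        by (auto simp: \<chi>_def lits_below dest: set_zip_rightD)
      then show False using fresh p by auto
    qed
    moreover have "p \<notin> vars \<phi>q"
    proof
      assume "p \<in> vars \<phi>q"
      then obtain x where x: "x \<in> vars \<phi>" "p \<in> vars (rename ps qs x)"
        by (auto simp: \<phi>q_def vars_subst)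
      show False
      proof (cases "x \<in> set ps")
        case True
        then obtain q where "(x, q) \<in> set (zip ps qs)" "q \<in> set qs"
          using zip_partner[OF len] by blast
        then show False
          using x(2) rename_zip[of ps x q qs] dist fresh p by auto
      next
        case False
        then show False
          using x(2) rename_notin[OF False] p by simp
      qed
    qed
    ultimately show "Neg p \<notin> lits \<iota>"
      using lits by (auto simp: imp_def vars_def)
  qed

  \<comment> \<open>Substituting \<open>p\<close> for \<open>q\<close> fixes \<open>\<iota>\<close>, restores \<open>\<phi>\<close>, and trivialises the guard.\<close>
  moreover have "imp \<iota> \<phi> \<in> \<Lambda>"
  proof -
    define \<theta> where "\<theta> = rename qs ps"
    have "subst \<theta> \<iota> = \<iota>"
      using vars\<iota> fresh by (intro subst_identity) (auto simp: \<theta>_def intro!: rename_notin)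
    moreover have "subst \<theta> \<phi>q = \<phi>"
      unfolding \<phi>q_def \<theta>_def subst_subst
      using vars fresh dist len qs by (intro subst_identity rename_back) auto
    ultimately have "imp \<iota> (imp (guard (subst \<theta> \<chi>) \<phi>) \<phi>) \<in> \<Lambda>"
      using logic_subst[OF ml \<iota>2, of \<theta>] by (simp add: subst_guard)
    moreover have "subst \<theta> \<chi> \<in> \<Lambda>"
    proof (rule modal_logic_contains_truths[OF ml])
      fix v
      have "\<theta> p = \<theta> q" if "(p, q) \<in> set (zip ps qs)" for p q
      proof -
        have "p \<notin> set qs"
          using set_zip_leftD[OF that] fresh by auto
        then show ?thesis
          unfolding \<theta>_def
          using rename_notin rename_zip[OF qs zip_commute_set[OF that]] by simp
      qed
      then show "truth v (subst \<theta> \<chi>)"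
        by (auto simp: \<chi>_def truth_subst_below)
    qed
    then have "guard (subst \<theta> \<chi>) \<phi> \<in> \<Lambda>"
      by (rule guard_theorem[OF assms(1)])
    ultimately show ?thesis
      by (intro propositional_consequence[OF ml,
            of "[imp \<iota> (imp (guard (subst \<theta> \<chi>) \<phi>) \<phi>), guard (subst \<theta> \<chi>) \<phi>]"]) auto
  qed
  then have "iff \<phi> \<iota> \<in> \<Lambda>"
    using \<iota>1 by (intro propositional_consequence[OF ml, of "[imp \<phi> \<iota>, imp \<iota> \<phi>]"]) auto
  ultimately show "\<exists>\<alpha>. vars \<alpha> \<subseteq> set (ps @ rs) \<and> positive_in ps \<alpha> \<and> iff \<phi> \<alpha> \<in> \<Lambda>"
    using vars\<iota> by blast
qed

end
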